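(* The deterministic prompt mechanism HonestGreedy (defined in the context) is truthful for myopic agents, and it is $2$-competitive: on every instance, with truthful reports, $\mathrm{OPT}\le 2\cdot \mathrm{SW}(\mu)$, where $\mu$ is the matching it produces and $\mathrm{OPT}$ is the welfare of the best offline matching. The factor $2$ is tight even for (not necessarily truthful) deterministic online algorithms: no deterministic online algorithm is $\alpha$-competitive for any $\alpha<2$.
   Context: Model. There is a bipartite graph $G=(B,I;E)$ with a set $B$ of $n$ buyers, known in advance, and a set $I$ of $m$ items arriving one by one in an unknown, possibly adversarial order (item $j$ arrives at time $j$). Buyer $i$ is interested in the items $j$ with $(i,j)\in E$, and has a value $v_i\ge 0$ for obtaining at least one item she is interested in (value $0$ otherwise). The edges and values are private information of the buyers. When item $j$ arrives, every buyer $i$ declares whether she is interested in it and, if so, a value; $b_{i,j}$ denotes her bid, with $b_{i,j}=0$ if not interested. All nonzero bids of a buyer must be equal to one value $b_i$. An online mechanism (or algorithm) decides immediately and irrevocably, using only the bids on items up to $j$, either to assign $j$ to a buyer who declared interest in it and has not been assigned an item yet, or to leave $j$ unassigned forever. The result is a matching $\mu$ ($\mu_j$ is the buyer receiving $j$; $\mu^{-1}_i$ is the item received by $i$, $\emptyset$ if none). The mechanism also charges non-negative payments $p_i$; it is prompt if $p_i$ is determined at the moment buyer $i$ is assigned an item. Welfare. $\mathrm{SW}(\mu)=\sum_{i\in B} v_i\cdot \mathbb{I}[(i,\mu^{-1}_i)\in E]$, and $\mathrm{OPT}=\mathrm{SW}(\mu^\star)$ where $\mu^\star$ is a maximum weight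 matching in $G$. A mechanism/algorithm is $\alpha$-competitive ($\alpha\ge 1$) if $\mathrm{OPT}\le\alpha\cdot \mathbb{E}[\mathrm{SW}(\mu)]$ on every instance. For the tightness claim, a (non-truthful) algorithm is one that receives the true values and edges online. Myopic agents. Upon arrival of item $j$, a myopic buyer $i$ maximizes only the utility of that round, $u_{i,j}=v_i\cdot\mathbb{I}[\mu_j=i,\ (i,j)\in E]-p_i$ (where $p_i$ is what she is charged in this round). A mechanism is truthful for myopic agents if in each round it is always in the best interest of a myopic buyer to declare truthfully. Mechanisms are required to be ex-post individually rational (utilities of truthful agents are non-negative). HonestGreedy. Every time an item arrives, run a second-price auction among the not-yet-assigned buyers who declare interest in it: the item goes to the highest bidder (ties broken by a fixed rule), who is immediately charged the second highest bid among these buyers ($0$ if there is none). If no unassigned buyer is interested, the item is discarded. *)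

theory Defs
  imports Complex_Main
begin

text \<open>
  Buyers are \<open>0, ..., n - 1\<close>; items are \<open>0, ..., m - 1\<close>, numbered by arrival time, so that the
  (adversarial) arrival order is part of the market.
\<close>

record market =
  num_buyers :: nat
  num_items :: nat
  edges :: "(nat \<times> nat) set"
  valuation :: "nat \<Rightarrow> real"

definition valid_market :: "market \<Rightarrow> bool" where
  "valid_market G \<longleftrightarrow>
     edges G \<subseteq> {..<num_buyers G} \<times> {..<num_items G} \<and>
     (\<forall>i<num_buyers G. 0 \<le> valuation G i)"

text \<open>
  An assignment maps each item to the buyer receiving it, if any.
\<close>

type_synonym assignment = "nat \<Rightarrow> nat option"

definition matching :: "market \<Rightarrow> assignment \<Rightarrow> bool" where
  "matching G \<mu> \<longleftrightarrow>
     (\<forall>i j. \<mu> j = Some i \<longrightarrow> (i, j) \<in> edges G) \<and>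
     (\<forall>i j k. \<mu> j = Some i \<and> \<mu> k = Some i \<longrightarrow> j = k)"

definition social_welfare :: "market \<Rightarrow> assignment \<Rightarrow> real" where
  "social_welfare G \<mu> =
     (\<Sum>i<num_buyers G. valuation G i * of_bool (\<exists>j. \<mu> j = Some i \<and> (i, j) \<in> edges G))"

definition opt_welfare :: "market \<Rightarrow> real" where
  "opt_welfare G = Max (social_welfare G ` {\<mu>. matching G \<mu>})"

text \<open>
  A report collects what all buyers declare for one item: \<open>None\<close> means not interested,
  \<open>Some b\<close> means interested with declared value \<open>b\<close>. Keeping interest separate from the bid
  distinguishes a buyer who declares interest with value 0 from one who declares no interest.
  A list of reports contains the reports for the items \<open>0, 1, ...\<close> in order of arrival.
\<close>

type_synonym report = "nat \<Rightarrow> real option"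

definition bid :: "report \<Rightarrow> nat \<Rightarrow> real" where
  "bid c i = (case c i of None \<Rightarrow> 0 | Some b \<Rightarrow> b)"

definition admissible_reports :: "nat \<Rightarrow> report list \<Rightarrow> bool" where
  "admissible_reports n h \<longleftrightarrow>
     (\<forall>c\<in>set h. \<forall>i. (n \<le> i \<longrightarrow> c i = None) \<and> 0 \<le> bid c i) \<and>
     (\<forall>c\<in>set h. \<forall>c'\<in>set h. \<forall>i. bid c i \<noteq> 0 \<and> bid c' i \<noteq> 0 \<longrightarrow> bid c i = bid c' i)"

definition truthful_report :: "market \<Rightarrow> nat \<Rightarrow> report" where
  "truthful_report G j = (\<lambda>i. if (i, j) \<in> edges G then Some (valuation G i) else None)"

definition truthful_reports :: "market \<Rightarrow> report list" where
  "truthful_reports G = map (truthful_report G) [0..<num_items G]"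

text \<open>
  A deterministic online algorithm knows the number of buyers, the reports for all earlier
  items and the report for the current item; it does not know the number of items. Its own earlier
  decisions are determined by the earlier reports.
\<close>

type_synonym algorithm = "nat \<Rightarrow> report list \<Rightarrow> report \<Rightarrow> nat option"

definition outcome :: "algorithm \<Rightarrow> nat \<Rightarrow> report list \<Rightarrow> assignment" where
  "outcome A n h = (\<lambda>j. if j < length h then A n (take j h) (h ! j) else None)"

definition feasible_on :: "algorithm \<Rightarrow> nat \<Rightarrow> report list \<Rightarrow> bool" where
  "feasible_on A n h \<longleftrightarrow>
     (\<forall>j<length h. \<forall>i. outcome A n h j = Some i \<longrightarrow>
        i < n \<and> (h ! j) i \<noteq> None \<and> (\<forall>k<j. outcome A n h k \<noteq> Some i))"

text \<open>
  An algorithm that is not asked to elicit anything is only ever run on true values and edges.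
\<close>

definition online_algorithm :: "algorithm \<Rightarrow> bool" where
  "online_algorithm A \<longleftrightarrow>
     (\<forall>G. valid_market G \<longrightarrow> feasible_on A (num_buyers G) (truthful_reports G))"

definition competitive :: "real \<Rightarrow> algorithm \<Rightarrow> bool" where
  "competitive \<alpha> A \<longleftrightarrow> 1 \<le> \<alpha> \<and>
     (\<forall>G. valid_market G \<longrightarrow>
        opt_welfare G \<le>
        \<alpha> * social_welfare G (outcome A (num_buyers G) (truthful_reports G)))"

text \<open>
  \<open>charge M n h c i\<close> is what buyer \<open>i\<close> is charged in the round in which, after the earlier
  reports \<open>h\<close>, the report is \<open>c\<close>; \<open>payment M n h i\<close> is her total payment after \<open>h\<close>.
\<close>

record mechanism =
  assign :: algorithm
  charge :: "nat \<Rightarrow> report list \<Rightarrow> report \<Rightarrow> nat \<Rightarrow> real"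

definition payment :: "mechanism \<Rightarrow> nat \<Rightarrow> report list \<Rightarrow> nat \<Rightarrow> real" where
  "payment M n h i = (\<Sum>j<length h. charge M n (take j h) (h ! j) i)"

definition individually_rational :: "mechanism \<Rightarrow> bool" where
  "individually_rational M \<longleftrightarrow>
     (\<forall>G h i. valid_market G \<and> i < num_buyers G \<and>
        admissible_reports (num_buyers G) h \<and> length h = num_items G \<and>
        (\<forall>j<num_items G. (h ! j) i = truthful_report G j i) \<longrightarrow>
        0 \<le> valuation G i *
              of_bool (\<exists>j. outcome (assign M) (num_buyers G) h j = Some i \<and> (i, j) \<in> edges G)
            - payment M (num_buyers G) h i)"

definition online_mechanism :: "mechanism \<Rightarrow> bool" where
  "online_mechanism M \<longleftrightarrow>
     (\<forall>n h. admissible_reports n h \<longrightarrow> feasible_on (assign M) n h) \<and>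
     (\<forall>n h c i. admissible_reports n (h @ [c]) \<and> i < n \<longrightarrow> 0 \<le> charge M n h c i) \<and>
     individually_rational M"

definition prompt :: "mechanism \<Rightarrow> bool" where
  "prompt M \<longleftrightarrow>
     (\<forall>n h h' i j. admissible_reports n (h @ h') \<and> outcome (assign M) n h j = Some i \<longrightarrow>
        payment M n (h @ h') i = payment M n h i)"

definition round_utility ::
  "mechanism \<Rightarrow> market \<Rightarrow> report list \<Rightarrow> report \<Rightarrow> nat \<Rightarrow> real" where
  "round_utility M G h c i =
     valuation G i *
       of_bool (assign M (num_buyers G) h c = Some i \<and> (i, length h) \<in> edges G)
     - charge M (num_buyers G) h c i"

text \<open>
  The earlier reports \<open>h\<close> (also what buyer \<open>i\<close> herself declared) and what the other buyers
  declare in this round are arbitrary. Both truth-telling and the deviation \<open>d\<close> have to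
  respect the rule that all nonzero bids of a buyer agree.
\<close>

definition truthful_for_myopic_agents :: "mechanism \<Rightarrow> bool" where
  "truthful_for_myopic_agents M \<longleftrightarrow>
     (\<forall>G h c i d. valid_market G \<and> i < num_buyers G \<and> length h < num_items G \<and>
        admissible_reports (num_buyers G) (h @ [c(i := truthful_report G (length h) i)]) \<and>
        admissible_reports (num_buyers G) (h @ [c(i := d)]) \<longrightarrow>
        round_utility M G h (c(i := d)) i
        \<le> round_utility M G h (c(i := truthful_report G (length h) i)) i)"

text \<open>
  The tie-breaking rule selects the winner from the set of all highest bidders.
\<close>

definition tie_breaking_rule :: "(nat set \<Rightarrow> nat) \<Rightarrow> bool" where
  "tie_breaking_rule tie \<longleftrightarrow> (\<forall>S. finite S \<and> S \<noteq> {} \<longrightarrow> tie S \<in> S)"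

definition interested :: "nat set \<Rightarrow> report \<Rightarrow> nat set" where
  "interested F c = {i \<in> F. c i \<noteq> None}"

definition auction_winner :: "(nat set \<Rightarrow> nat) \<Rightarrow> nat set \<Rightarrow> report \<Rightarrow> nat option" where
  "auction_winner tie F c =
     (if interested F c = {} then None
      else Some (tie {i \<in> interested F c. \<forall>k\<in>interested F c. bid c k \<le> bid c i}))"

text \<open>
  If \<open>w\<close> is a highest bidder, the second highest bid is the highest bid of the other bidders.
\<close>

definition second_price :: "nat set \<Rightarrow> report \<Rightarrow> nat \<Rightarrow> real" where
  "second_price F c w =
     (if interested F c - {w} = {} then 0 else Max (bid c ` (interested F c - {w})))"

definition unassigned :: "(nat set \<Rightarrow> nat) \<Rightarrow> nat \<Rightarrow> report list \<Rightarrow> nat set" where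
  "unassigned tie n h = foldl (\<lambda>F c. F - set_option (auction_winner tie F c)) {..<n} h"

definition honest_greedy :: "(nat set \<Rightarrow> nat) \<Rightarrow> mechanism" where
  "honest_greedy tie =
     \<lparr> assign = (\<lambda>n h c. auction_winner tie (unassigned tie n h) c),
       charge = (\<lambda>n h c i.
         if auction_winner tie (unassigned tie n h) c = Some i
         then second_price (unassigned tie n h) c i else 0) \<rparr>"

end

theory Submission
  imports Defs
begin

text \<open>
  Competitiveness is a charging argument: a buyer served in the optimal matching but not by
  HonestGreedy was still available when her optimal item arrived, so that item went to a buyer of at
  least her value; charging her to that buyer is injective, and the remaining optimal buyers are
  served by HonestGreedy themselves. For tightness, a first item interests two buyers of value 1;
  if it is left unassigned, the market ends, and otherwise a second item interests only the buyer
  who received the first one.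
\<close>

section \<open>Welfare of matchings\<close>

text \<open>Every assigned pair of a matching is an edge, so the welfare depends only on the set of
  served buyers. Later comparisons of welfares become comparisons of sums over such sets.\<close>

lemma social_welfare_matching:
  assumes "matching G \<mu>"
  shows "social_welfare G \<mu> = sum (valuation G) {i. i < num_buyers G \<and> (\<exists>j. \<mu> j = Some i)}"
proof -
  have "(\<exists>j. \<mu> j = Some i \<and> (i, j) \<in> edges G) \<longleftrightarrow> (\<exists>j. \<mu> j = Some i)" for i
    using assms unfolding matching_def by blast
  then have "social_welfare G \<mu> =
      (\<Sum>i<num_buyers G. if \<exists>j. \<mu> j = Some i then valuation G i else 0)"
    unfolding social_welfare_def by (intro sum.cong) auto
  also have "\<dots> = sum (valuation G) {i \<in> {..<num_buyers G}. \<exists>j. \<mu> j = Some i}"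
    by (rule sum.inter_filter [symmetric]) simp
  finally show ?thesis by simp
qed

text \<open>Makes \<open>Max\<close> in \<open>opt_welfare\<close> meaningful. For arbitrary
  \<open>G\<close> there may be infinitely many matchings, but only finitely many sets of served
  buyers.\<close>

lemma finite_matching_welfares: "finite (social_welfare G ` {\<mu>. matching G \<mu>})"
proof (rule finite_subset)
  show "social_welfare G ` {\<mu>. matching G \<mu>} \<subseteq> sum (valuation G) ` Pow {..<num_buyers G}"
    using social_welfare_matching by fastforce
qed simp

lemma social_welfare_le_opt: "matching G \<mu> \<Longrightarrow> social_welfare G \<mu> \<le> opt_welfare G"
  unfolding opt_welfare_def by (rule Max_ge[OF finite_matching_welfares]) simp

lemma opt_welfare_le:
  assumes "\<And>\<mu>. matching G \<mu> \<Longrightarrow> social_welfare G \<mu> \<le> C"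
  shows "opt_welfare G \<le> C"
proof -
  \<comment> \<open>The empty assignment makes the set under \<open>Max\<close> nonempty, as
    \<open>Max_le_iff\<close> requires.\<close>
  have "matching G (\<lambda>_. None)"
    by (simp add: matching_def)
  then show ?thesis
    unfolding opt_welfare_def using assms
    by (subst Max_le_iff[OF finite_matching_welfares]) auto
qed

section \<open>Truthful reports and outcomes of online algorithms\<close>

lemma length_truthful_reports [simp]: "length (truthful_reports G) = num_items G"
  by (simp add: truthful_reports_def)

lemma nth_truthful_reports [simp]:
  "j < num_items G \<Longrightarrow> truthful_reports G ! j = truthful_report G j"
  by (simp add: truthful_reports_def)

lemma outcome_lessD: "outcome A n h j = Some i \<Longrightarrow> j < length h"
  by (simp add: outcome_def split: if_splits)

lemma outcome_append:
  "j < length h \<Longrightarrow> outcome A n (h @ h') j = outcome A n h j"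
  by (simp add: outcome_def nth_append)

text \<open>\<open>feasible_on\<close> only looks back at earlier items; ordering \<open>j\<close>
  and \<open>k\<close> gives the symmetric form.\<close>

lemma feasible_on_inj:
  assumes "feasible_on A n h" "outcome A n h j = Some i" "outcome A n h k = Some i"
  shows "j = k"
  using assms outcome_lessD[OF assms(2)] outcome_lessD[OF assms(3)]
  unfolding feasible_on_def by (metis linorder_neqE_nat)

text \<open>On truthful reports, declared interest means an edge. Serves both HonestGreedy and the
  lower bound.\<close>

lemma matching_outcome:
  assumes "feasible_on A n (truthful_reports G)"
  shows "matching G (outcome A n (truthful_reports G))"
  unfolding matching_def
proof (intro conjI allI impI)
  fix i j
  assume o: "outcome A n (truthful_reports G) j = Some i"
  then have "j < num_items G"
    using outcome_lessD by fastforce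
  with assms o have "truthful_report G j i \<noteq> None"
    unfolding feasible_on_def by fastforce
  then show "(i, j) \<in> edges G"
    by (simp add: truthful_report_def split: if_splits)
qed (use feasible_on_inj[OF assms] in blast)

section \<open>The single-item auction\<close>

lemma auction_winnerD:
  assumes "tie_breaking_rule tie" "finite F" "auction_winner tie F c = Some w"
  shows "w \<in> interested F c" "\<And>k. k \<in> interested F c \<Longrightarrow> bid c k \<le> bid c w"
proof -
  let ?I = "interested F c"
  let ?S = "{i \<in> ?I. \<forall>k\<in>?I. bid c k \<le> bid c i}"
  have ne: "?I \<noteq> {}" and w: "w = tie ?S"
    using assms(3) by (auto simp: auction_winner_def split: if_splits)
  have fin: "finite ?I"
    using assms(2) by (simp add: interested_def)
  \<comment> \<open>The highest bid is attained, so the set handed to \<open>tie\<close> is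
    nonempty; only then is its choice constrained.\<close>
  have "Max (bid c ` ?I) \<in> bid c ` ?I"
    using fin ne by simp
  then obtain i where "i \<in> ?I" "bid c i = Max (bid c ` ?I)"
    by auto
  then have "i \<in> ?S"
    using fin by simp
  then have "?S \<noteq> {}" by blast
  moreover have "finite ?S"
    using fin by simp
  ultimately have "tie ?S \<in> ?S"
    using assms(1) unfolding tie_breaking_rule_def by blast
  then show "w \<in> interested F c" "\<And>k. k \<in> interested F c \<Longrightarrow> bid c k \<le> bid c w"
    using w by auto
qed

lemma auction_winner_ex: "k \<in> interested F c \<Longrightarrow> \<exists>w. auction_winner tie F c = Some w"
  by (auto simp: auction_winner_def)

lemma second_price_nonneg:
  assumes "finite F" "\<And>k. k \<noteq> w \<Longrightarrow> 0 \<le> bid c k"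
  shows "0 \<le> second_price F c w"
proof (cases "interested F c - {w} = {}")
  case False
  then obtain k where "k \<in> interested F c - {w}" by blast
  then have "0 \<le> bid c k" "bid c k \<le> Max (bid c ` (interested F c - {w}))"
    using assms by (auto simp: interested_def)
  then show ?thesis
    using False by (simp add: second_price_def)
qed (simp add: second_price_def)

text \<open>Since \<open>w\<close> is arbitrary, this also bounds from below the price that a
  truthful loser would pay if she won by deviating.\<close>

lemma bid_le_second_price:
  assumes "finite F" "k \<in> interested F c" "k \<noteq> w"
  shows "bid c k \<le> second_price F c w"
  using assms by (auto simp: second_price_def interested_def)

lemma second_price_le_bid:
  assumes "tie_breaking_rule tie" "finite F" "auction_winner tie F c = Some w" "0 \<le> bid c w"
  shows "second_price F c w \<le> bid c w"
proof (cases "interested F c - {w} = {}")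
  case False
  have "finite (interested F c)"
    using assms(2) by (simp add: interested_def)
  then show ?thesis
    using False auction_winnerD(2)[OF assms(1-3)] by (simp add: second_price_def)
qed (use assms(4) in \<open>simp add: second_price_def\<close>)

text \<open>The core of truthfulness: a buyer's own report decides whether she wins, never the price
  she faces.\<close>

lemma second_price_fun_upd: "second_price F (c(w := d)) w = second_price F c w"
proof -
  have "interested F (c(w := d)) - {w} = interested F c - {w}"
    by (auto simp: interested_def)
  moreover have "bid (c(w := d)) ` (interested F c - {w}) = bid c ` (interested F c - {w})"
    by (rule image_cong) (auto simp: bid_def)
  ultimately show ?thesis
    by (simp only: second_price_def)
qed

section \<open>HonestGreedy as a mechanism\<close>

lemma assign_honest_greedy:
  "assign (honest_greedy tie) n h c = auction_winner tie (unassigned tie n h) c"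
  by (simp add: honest_greedy_def)

lemma outcome_honest_greedy:
  "j < length h \<Longrightarrow> outcome (assign (honest_greedy tie)) n h j =
     auction_winner tie (unassigned tie n (take j h)) (h ! j)"
  by (simp add: outcome_def assign_honest_greedy)

lemma charge_honest_greedy [simp]:
  "charge (honest_greedy tie) n h c i =
     (if auction_winner tie (unassigned tie n h) c = Some i
      then second_price (unassigned tie n h) c i else 0)"
  by (simp add: honest_greedy_def)

text \<open>Translates the folded state into the outcome so far; feasibility and the charging
  argument both rest on this description.\<close>

lemma unassigned_take:
  "j \<le> length h \<Longrightarrow> unassigned tie n (take j h) =
     {i. i < n \<and> (\<forall>k<j. outcome (assign (honest_greedy tie)) n h k \<noteq> Some i)}"
proof (induction j)
  case 0
  then show ?case by (auto simp: unassigned_def)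
next
  case (Suc j)
  have "unassigned tie n (take (Suc j) h) =
      unassigned tie n (take j h) - set_option (outcome (assign (honest_greedy tie)) n h j)"
    using Suc.prems by (simp add: take_Suc_conv_app_nth unassigned_def outcome_honest_greedy)
  then show ?case
    using Suc by (auto simp: less_Suc_eq)
qed

lemma finite_unassigned [simp]: "finite (unassigned tie n h)"
  using unassigned_take[of "length h" h tie n] by simp

context
  fixes tie :: "nat set \<Rightarrow> nat"
  assumes tie: "tie_breaking_rule tie"
begin

lemma outcome_honest_greedyD:
  assumes "outcome (assign (honest_greedy tie)) n h j = Some i"
  shows "auction_winner tie (unassigned tie n (take j h)) (h ! j) = Some i"
    and "i \<in> interested (unassigned tie n (take j h)) (h ! j)"
proof -
  show "auction_winner tie (unassigned tie n (take j h)) (h ! j) = Some i"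
    using assms outcome_honest_greedy[OF outcome_lessD[OF assms]] by simp
  then show "i \<in> interested (unassigned tie n (take j h)) (h ! j)"
    by (rule auction_winnerD(1)[OF tie finite_unassigned])
qed

lemma feasible_honest_greedy: "feasible_on (assign (honest_greedy tie)) n h"
  unfolding feasible_on_def
proof (intro allI impI)
  fix j i
  assume "j < length h" "outcome (assign (honest_greedy tie)) n h j = Some i"
  then show "i < n \<and> (h ! j) i \<noteq> None \<and>
      (\<forall>k<j. outcome (assign (honest_greedy tie)) n h k \<noteq> Some i)"
    using outcome_honest_greedyD(2)[of n h j i] unassigned_take[of j h tie n]
    by (auto simp: interested_def)
qed

section \<open>Payments and the requirements on mechanisms\<close>

text \<open>By feasibility \<open>i\<close> wins in no other round than \<open>j\<close>, so the sum
  of charges collapses to a single price.\<close>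

lemma payment_honest_greedy:
  assumes "outcome (assign (honest_greedy tie)) n h j = Some i"
  shows "payment (honest_greedy tie) n h i =
    second_price (unassigned tie n (take j h)) (h ! j) i"
proof -
  have "charge (honest_greedy tie) n (take k h) (h ! k) i =
      (if k = j then second_price (unassigned tie n (take j h)) (h ! j) i else 0)"
    if "k < length h" for k
  proof -
    have "auction_winner tie (unassigned tie n (take k h)) (h ! k) = Some i \<longleftrightarrow> k = j"
      unfolding outcome_honest_greedy[OF that, symmetric]
      using feasible_on_inj[OF feasible_honest_greedy assms] assms by blast
    then show ?thesis
      by simp
  qed
  then have "payment (honest_greedy tie) n h i =
      (\<Sum>k<length h. if k = j then second_price (unassigned tie n (take j h)) (h ! j) i else 0)"
    unfolding payment_def by (intro sum.cong) auto
  then show ?thesis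
    using outcome_lessD[OF assms] by simp
qed

lemma payment_honest_greedy_loser:
  assumes "\<And>j. outcome (assign (honest_greedy tie)) n h j \<noteq> Some i"
  shows "payment (honest_greedy tie) n h i = 0"
  unfolding payment_def
proof (rule sum.neutral, rule ballI)
  fix j assume "j \<in> {..<length h}"
  then show "charge (honest_greedy tie) n (take j h) (h ! j) i = 0"
    using assms[of j] by (simp add: outcome_honest_greedy)
qed

text \<open>A truthful winner bids her value, which bounds the price; a loser pays nothing.\<close>

lemma individually_rational_honest_greedy: "individually_rational (honest_greedy tie)"
  unfolding individually_rational_def
proof (intro allI impI, elim conjE)
  fix G :: market and h i
  let ?o = "outcome (assign (honest_greedy tie)) (num_buyers G) h"
  assume G: "valid_market G" and i: "i < num_buyers G" and len: "length h = num_items G"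
    and truth: "\<forall>j<num_items G. (h ! j) i = truthful_report G j i"
  show "0 \<le> valuation G i * of_bool (\<exists>j. ?o j = Some i \<and> (i, j) \<in> edges G)
      - payment (honest_greedy tie) (num_buyers G) h i"
  proof (cases "\<exists>j. ?o j = Some i")
    case True
    then obtain j where j: "?o j = Some i" by blast
    note win = outcome_honest_greedyD[OF j]
    have "(h ! j) i = truthful_report G j i" "(h ! j) i \<noteq> None"
      using truth len outcome_lessD[OF j] win(2) by (auto simp: interested_def)
    then have edge: "(i, j) \<in> edges G" and bid: "bid (h ! j) i = valuation G i"
      by (auto simp: truthful_report_def bid_def split: if_splits)
    have "payment (honest_greedy tie) (num_buyers G) h i \<le> bid (h ! j) i"
      unfolding payment_honest_greedy[OF j]
      using G i bid by (intro second_price_le_bid[OF tie _ win(1)]) (auto simp: valid_market_def)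
    moreover have "\<exists>j. ?o j = Some i \<and> (i, j) \<in> edges G"
      using j edge by blast
    ultimately show ?thesis
      using bid by simp
  qed (simp add: payment_honest_greedy_loser)
qed

lemma online_mechanism_honest_greedy: "online_mechanism (honest_greedy tie)"
  unfolding online_mechanism_def
  by (auto simp: admissible_reports_def feasible_honest_greedy individually_rational_honest_greedy
      intro!: second_price_nonneg)

text \<open>Appending reports changes neither the round that \<open>i\<close> wins nor the reports
  up to it, so \<open>payment_honest_greedy\<close> gives the same price for both lists.\<close>

lemma prompt_honest_greedy: "prompt (honest_greedy tie)"
  unfolding prompt_def
proof (intro allI impI, elim conjE)
  fix n h h' i j
  assume j: "outcome (assign (honest_greedy tie)) n h j = Some i"
  then have "outcome (assign (honest_greedy tie)) n (h @ h') j = Some i"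
    by (simp add: outcome_append outcome_lessD)
  from payment_honest_greedy[OF this] payment_honest_greedy[OF j] outcome_lessD[OF j]
  show "payment (honest_greedy tie) n (h @ h') i = payment (honest_greedy tie) n h i"
    by (simp add: nth_append)
qed

text \<open>The price \<open>?p\<close> is the same for truth and deviation. Truth never yields a
  negative utility, so only a deviation that wins an item of interest matters: truth then wins at
  the same price, or loses because \<open>?p\<close> is at least the value.\<close>

lemma truthful_honest_greedy: "truthful_for_myopic_agents (honest_greedy tie)"
  unfolding truthful_for_myopic_agents_def
proof (intro allI impI, elim conjE)
  fix G :: market and h :: "report list" and c :: report and i d
  define t where "t = c(i := truthful_report G (length h) i)"
  define e where "e = c(i := d)"
  let ?F = "unassigned tie (num_buyers G) h"
  let ?p = "second_price ?F c i"
  assume G: "valid_market G" "i < num_buyers G"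
    and adm: "admissible_reports (num_buyers G) (h @ [c(i := truthful_report G (length h) i)])"
  have v: "0 \<le> valuation G i"
    using G by (simp add: valid_market_def)
  have bid_t: "0 \<le> bid t k" for k
    using adm by (simp add: admissible_reports_def t_def)
  have p_t: "second_price ?F t i = ?p" and p_e: "second_price ?F e i = ?p"
    by (simp_all add: t_def e_def second_price_fun_upd)
  have p: "0 \<le> ?p"
    using second_price_nonneg[of ?F i t] bid_t p_t by simp
  have edge_t: "(i, length h) \<in> edges G \<and> bid t i = valuation G i" if "t i \<noteq> None"
    using that by (auto simp: t_def truthful_report_def bid_def split: if_splits)
  have truth_nonneg: "0 \<le> round_utility (honest_greedy tie) G h t i"
  proof (cases "auction_winner tie ?F t = Some i")
    case True
    then have "t i \<noteq> None"
      using auction_winnerD(1)[OF tie _ True] by (simp add: interested_def)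
    then have "(i, length h) \<in> edges G" "bid t i = valuation G i"
      using edge_t by auto
    then show ?thesis
      using True second_price_le_bid[OF tie finite_unassigned True bid_t] by (simp add: round_utility_def assign_honest_greedy)
  qed (simp add: round_utility_def assign_honest_greedy)
  have "round_utility (honest_greedy tie) G h e i \<le> round_utility (honest_greedy tie) G h t i"
  proof (cases "auction_winner tie ?F e = Some i \<and> (i, length h) \<in> edges G")
    case True
    then have u_e: "round_utility (honest_greedy tie) G h e i = valuation G i - ?p"
      by (simp add: round_utility_def assign_honest_greedy p_e)
    have "i \<in> ?F"
      using auction_winnerD(1)[OF tie, of ?F e i] True by (simp add: interested_def)
    then have i: "i \<in> interested ?F t"
      using True by (simp add: interested_def t_def truthful_report_def)
    then obtain w where w: "auction_winner tie ?F t = Some w"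
      using auction_winner_ex by blast
    show ?thesis
    proof (cases "w = i")
      case True
      then show ?thesis
        using w u_e p_t \<open>_ \<and> _\<close> by (simp add: round_utility_def assign_honest_greedy)
    next
      case False
      \<comment> \<open>The truthful winner bids at least the value of \<open>i\<close>, and her bid
        is among those that set \<open>?p\<close>, so the deviation gains at most 0.\<close>
      have "bid t i \<le> bid t w" "w \<in> interested ?F t"
        using auction_winnerD[OF tie _ w] i by auto
      moreover from this have "bid t w \<le> ?p"
        using bid_le_second_price[of ?F w t i] False p_t by simp
      moreover have "bid t i = valuation G i"
        using edge_t i by (simp add: interested_def)
      ultimately show ?thesis
        using u_e truth_nonneg by simp
    qed
  next
    case False
    \<comment> \<open>A deviation that does not win costs nothing; winning without an edge has no
      value and costs \<open>?p\<close>.\<close>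
    then have "round_utility (honest_greedy tie) G h e i \<le> 0"
      using p by (auto simp: round_utility_def assign_honest_greedy p_e)
    then show ?thesis
      using truth_nonneg by simp
  qed
  then show "round_utility (honest_greedy tie) G h (c(i := d)) i
      \<le> round_utility (honest_greedy tie) G h (c(i := truthful_report G (length h) i)) i"
    by (simp add: t_def e_def)
qed

section \<open>Competitive ratio\<close>

lemma competitive_honest_greedy: "competitive 2 (assign (honest_greedy tie))"
  unfolding competitive_def
\<comment> \<open>\<open>opt_welfare_le\<close> reduces the bound to an arbitrary matching
  \<mu>.\<close>
proof (intro conjI allI impI opt_welfare_le)
  fix G :: market and \<mu> :: assignment
  let ?n = "num_buyers G" and ?h = "truthful_reports G" and ?v = "valuation G"
  let ?o = "outcome (assign (honest_greedy tie)) ?n ?h"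
  let ?O = "{i. i < ?n \<and> (\<exists>j. \<mu> j = Some i)}" and ?W = "{i. i < ?n \<and> (\<exists>j. ?o j = Some i)}"
  assume G: "valid_market G" and \<mu>: "matching G \<mu>"
  note feas = feasible_honest_greedy[of ?n ?h]
  have v: "0 \<le> ?v i" if "i < ?n" for i
    using G that by (simp add: valid_market_def)
  \<comment> \<open>The item \<open>j\<close> is kept in the statement because injectivity of the
    chosen \<open>g\<close> is read off from it.\<close>
  have "\<forall>i \<in> ?O - ?W. \<exists>w. \<exists>j. \<mu> j = Some i \<and> ?o j = Some w \<and> w < ?n \<and> ?v i \<le> ?v w"
  proof
    fix i assume i: "i \<in> ?O - ?W"
    from i obtain j where j: "\<mu> j = Some i" by blast
    then have edge: "(i, j) \<in> edges G"
      using \<mu> by (simp add: matching_def)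
    then have jm: "j < num_items G"
      using G by (auto simp: valid_market_def)
    let ?F = "unassigned tie ?n (take j ?h)"
    \<comment> \<open>\<open>i\<close> is never served by HonestGreedy, in particular not before
      item \<open>j\<close>.\<close>
    have "i \<in> ?F"
      using i jm by (subst unassigned_take) auto
    then have int: "i \<in> interested ?F (truthful_report G j)"
      using edge by (simp add: interested_def truthful_report_def)
    then obtain w where w: "auction_winner tie ?F (truthful_report G j) = Some w"
      using auction_winner_ex by blast
    then have o: "?o j = Some w"
      using jm by (simp add: outcome_honest_greedy)
    have w_edge: "(w, j) \<in> edges G"
      using matching_outcome[OF feas] o by (simp add: matching_def)
    have "bid (truthful_report G j) i \<le> bid (truthful_report G j) w"
      using auction_winnerD(2)[OF tie _ w int] by simp
    then have "?v i \<le> ?v w"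
      using edge w_edge by (simp add: bid_def truthful_report_def)
    moreover have "w < ?n"
      using w_edge G by (auto simp: valid_market_def)
    ultimately show "\<exists>w. \<exists>j. \<mu> j = Some i \<and> ?o j = Some w \<and> w < ?n \<and> ?v i \<le> ?v w"
      using j o by blast
  qed
  from bchoice[OF this] obtain g where g: "\<forall>i \<in> ?O - ?W.
      \<exists>j. \<mu> j = Some i \<and> ?o j = Some (g i) \<and> g i < ?n \<and> ?v i \<le> ?v (g i)" ..
  \<comment> \<open>HonestGreedy gives a buyer at most one item, so equal images come from the same
    item, which \<mu> gives to one buyer only.\<close>
  have inj: "inj_on g (?O - ?W)"
  proof (rule inj_onI)
    fix i i' assume i: "i \<in> ?O - ?W" and i': "i' \<in> ?O - ?W" and eq: "g i = g i'"
    obtain j where j: "\<mu> j = Some i" "?o j = Some (g i)"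
      using bspec[OF g i] by blast
    obtain j' where j': "\<mu> j' = Some i'" "?o j' = Some (g i)"
      using bspec[OF g i'] eq by auto
    have "j = j'"
      using feasible_on_inj[OF feas j(2) j'(2)] .
    then show "i = i'"
      using j(1) j'(1) by simp
  qed
  have "sum ?v (?O - ?W) \<le> (\<Sum>i\<in>?O - ?W. ?v (g i))"
    by (rule sum_mono) (use bspec[OF g] in blast)
  also have "\<dots> = sum ?v (g ` (?O - ?W))"
    using inj by (simp add: sum.reindex)
  also have "\<dots> \<le> sum ?v ?W"
  proof (rule sum_mono2)
    show "g ` (?O - ?W) \<subseteq> ?W"
    proof
      fix w assume "w \<in> g ` (?O - ?W)"
      then obtain i where "i \<in> ?O - ?W" "w = g i" ..
      then show "w \<in> ?W"
        using bspec[OF g, of i] by blast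
    qed
  qed (use v in auto)
  finally have "sum ?v (?O - ?W) \<le> sum ?v ?W" .
  \<comment> \<open>Both halves of \<open>?O\<close> are worth at most \<open>?W\<close>, which is
    where the factor 2 comes from.\<close>
  moreover have "sum ?v (?O \<inter> ?W) \<le> sum ?v ?W"
    using v by (intro sum_mono2) auto
  moreover have "sum ?v ?O = sum ?v (?O \<inter> ?W) + sum ?v (?O - ?W)"
    by (rule sum.Int_Diff) simp
  ultimately show "social_welfare G \<mu> \<le> 2 * social_welfare G ?o"
    by (simp add: social_welfare_matching[OF \<mu>] social_welfare_matching[OF matching_outcome[OF feas]])
qed simp

end

section \<open>Lower bound for deterministic online algorithms\<close>

lemma not_competitive:
  assumes A: "online_algorithm A" and "\<alpha> < 2"
  shows "\<not> competitive \<alpha> A"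
proof
  assume comp: "competitive \<alpha> A"
  \<comment> \<open>The optimum dominates every matching, so exhibiting one good matching per market
    suffices.\<close>
  have bound: "social_welfare G \<mu> \<le> \<alpha> * social_welfare G (outcome A (num_buyers G) (truthful_reports G))"
    if "valid_market G" "matching G \<mu>" for G \<mu>
    using comp that social_welfare_le_opt[OF that(2)] unfolding competitive_def by force
  have alg: "matching G (outcome A (num_buyers G) (truthful_reports G))" if "valid_market G" for G
    using A that by (intro matching_outcome) (simp add: online_algorithm_def)
  \<comment> \<open>The first report is the same in all markets below, so the algorithm's first
    decision cannot depend on which one it faces.\<close>
  define c :: report where "c = (\<lambda>i. if i < 2 then Some 1 else None)"
  show False
  proof (cases "A 2 [] c")
    case None
    \<comment> \<open>The algorithm gets welfare 0 here against 1, which refutes every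
      ratio.\<close>
    define G where "G = \<lparr>num_buyers = 2, num_items = 1, edges = {(0, 0), (1, 0)},
      valuation = (\<lambda>_. 1::real)\<rparr>"
    have G: "valid_market G"
      by (auto simp: valid_market_def G_def)
    have \<mu>: "matching G (\<lambda>j. if j = 0 then Some 0 else None)"
      by (auto simp: matching_def G_def split: if_splits)
    have c: "truthful_report G 0 = c"
      unfolding truthful_report_def G_def c_def by (auto simp: less_2_cases_iff)
    have "truthful_reports G = [c]"
      using c by (simp add: truthful_reports_def) (simp add: G_def)
    then have "outcome A 2 (truthful_reports G) = (\<lambda>_. None)"
      using None by (simp add: outcome_def fun_eq_iff)
    then show False
      using bound[OF G \<mu>]
      by (simp add: social_welfare_def G_def numeral_2_eq_2)
  next
    case (Some i)
    define G where "G = \<lparr>num_buyers = 2, num_items = 2, edges = {(0, 0), (1, 0), (i, 1)},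
      valuation = (\<lambda>_. 1::real)\<rparr>"
    let ?o = "outcome A 2 (truthful_reports G)"
    \<comment> \<open>Validity of \<open>G\<close> needs \<open>i < 2\<close>, but feasibility is
      only guaranteed on valid markets. The one-item market \<open>H\<close> supplies this bound
      first.\<close>
    define H where "H = \<lparr>num_buyers = 2, num_items = 1, edges = {(0, 0), (1, 0)},
      valuation = (\<lambda>_. 1::real)\<rparr>"
    have "valid_market H"
      by (auto simp: valid_market_def H_def)
    then have "matching H (outcome A 2 (truthful_reports H))"
      using alg[of H] by (simp add: H_def)
    moreover have "truthful_report H 0 = c"
      unfolding truthful_report_def H_def c_def by (auto simp: less_2_cases_iff)
    then have "truthful_reports H = [c]"
      by (simp add: truthful_reports_def) (simp add: H_def)
    then have "outcome A 2 (truthful_reports H) 0 = Some i"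
      using Some by (simp add: outcome_def)
    ultimately have i: "i = 0 \<or> i = 1"
      by (auto simp: matching_def H_def)
    then have G: "valid_market G"
      by (auto simp: valid_market_def G_def)
    \<comment> \<open>Item 0 goes to the other buyer, \<open>1 - i\<close>, which leaves
      \<open>i\<close> free for item 1.\<close>
    define \<mu> :: assignment where
      "\<mu> = (\<lambda>j. if j = 0 then Some (1 - i) else if j = 1 then Some i else None)"
    have \<mu>: "matching G \<mu>"
      using i by (auto simp: matching_def G_def \<mu>_def split: if_splits)
    have c: "truthful_report G 0 = c"
      unfolding truthful_report_def G_def c_def by (auto simp: less_2_cases_iff)
    have o: "matching G ?o"
      using alg[OF G] by (simp add: G_def)
    have o0: "?o 0 = Some i"
      using Some c by (simp add: outcome_def) (simp add: G_def)
    \<comment> \<open>Item 0 goes to \<open>i\<close>, and item 1 interests only \<open>i\<close>,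
      so nobody else can be served.\<close>
    have "k = i" if "?o j = Some k" for j k
    proof -
      have "(k, j) \<in> edges G"
        using o that by (auto simp: matching_def)
      then have "j = 0 \<or> k = i"
        by (auto simp: G_def)
      then show ?thesis
        using o0 that by auto
    qed
    then have "{k. k < num_buyers G \<and> (\<exists>j. ?o j = Some k)} = {i}"
      using o0 i by (auto simp: G_def)
    then have "social_welfare G ?o = 1"
      unfolding social_welfare_matching[OF o] by (simp add: G_def)
    moreover have "social_welfare G \<mu> = 2"
    proof -
      have "\<mu> 0 = Some (1 - i)" "\<mu> 1 = Some i"
        by (simp_all add: \<mu>_def)
      then have "\<exists>j. \<mu> j = Some 0" "\<exists>j. \<mu> j = Some 1"
        using i by (metis diff_self_eq_0 diff_zero)+
      then have "{k. k < num_buyers G \<and> (\<exists>j. \<mu> j = Some k)} = {0, 1}"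
        by (auto simp: G_def less_2_cases_iff)
      then show ?thesis
        unfolding social_welfare_matching[OF \<mu>] by (simp add: G_def)
    qed
    ultimately show False
      using bound[OF G \<mu>] \<open>\<alpha> < 2\<close> by (simp add: G_def)
  qed
qed

theorem theorem1:
  shows "(\<forall>tie. tie_breaking_rule tie \<longrightarrow>
            online_mechanism (honest_greedy tie) \<and>
            prompt (honest_greedy tie) \<and>
            truthful_for_myopic_agents (honest_greedy tie) \<and>
            competitive 2 (assign (honest_greedy tie))) \<and>
         (\<forall>A \<alpha>. online_algorithm A \<and> \<alpha> < 2 \<longrightarrow> \<not> competitive \<alpha> A)"
  using online_mechanism_honest_greedy prompt_honest_greedy truthful_honest_greedy
    competitive_honest_greedy not_competitive by blast

end
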